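(* Let $Y$ be a Banach sequence lattice and $E$ a Banach space. Then $\ell^{Y}(E)$ and $\ell_0^{Y}(E)$ are Banach spaces. If in addition $E$ is a Banach lattice, then $\ell^{Y}(E)$ and $\ell_0^{Y}(E)$ are Banach lattices (with the componentwise order).
   Context: All vector spaces are real. A Banach sequence lattice is a linear subspace $Y\subset\mathbb{R}^{\mathbb{N}}$ containing all canonical sequences $e_n$, with a complete norm $\|\cdot\|_Y$ such that if $f\in\mathbb{R}^{\mathbb{N}}$, $g\in Y$ and $|f|\le|g|$ pointwise, then $f\in Y$ and $\|f\|_Y\le\|g\|_Y$. $\ell^{Y}(E):=\{\{w_j\}_{j=1}^\infty\in E^{\mathbb{N}}:\{\|w_j\|_E\}_{j=1}^\infty\in Y\}$ with norm $\|\{w_j\}\|_{\ell^Y(E)}:=\|\{\|w_j\|_E\}_{j}\|_Y$. $\ell_{00}^{Y}(E)$ is the subspace of eventually zero sequences, and $\ell_0^{Y}(E)$ is the closure of $\ell_{00}^{Y}(E)$ in $\ell^{Y}(E)$. *)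

theory Defs
  imports
    "HOL-Analysis.Analysis"
    "HOL-Library.Function_Algebras"
    "HOL-Algebra.Lattice"
begin

text \<open>
  The pointwise vector space structure on functions; addition, zero and subtraction are those of
  \<^theory>\<open>HOL-Library.Function_Algebras\<close> and of the main library.
\<close>

instantiation "fun" :: (type, real_vector) real_vector
begin

definition scaleR_fun :: "real \<Rightarrow> ('a \<Rightarrow> 'b) \<Rightarrow> 'a \<Rightarrow> 'b"
  where "scaleR_fun c f = (\<lambda>x. c *\<^sub>R f x)"

instance
  by standard (simp_all add: scaleR_fun_def fun_eq_iff scaleR_add_right scaleR_add_left)

end

text \<open>
  Normed spaces are linear subspaces \<open>V\<close> of an ambient real vector space, with a norm \<open>N\<close> of which
  only the values on \<open>V\<close> matter.
\<close>

definition normed_space_on :: "'v::real_vector set \<Rightarrow> ('v \<Rightarrow> real) \<Rightarrow> bool"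
  where "normed_space_on V N \<longleftrightarrow>
    subspace V \<and>
    (\<forall>x\<in>V. 0 \<le> N x) \<and>
    (\<forall>x\<in>V. N x = 0 \<longleftrightarrow> x = 0) \<and>
    (\<forall>c. \<forall>x\<in>V. N (c *\<^sub>R x) = \<bar>c\<bar> * N x) \<and>
    (\<forall>x\<in>V. \<forall>y\<in>V. N (x + y) \<le> N x + N y)"

text \<open>
  The metric induced by the norm. The value outside of \<open>V\<close> is irrelevant, but
  \<^locale>\<open>Metric_space\<close> requires nonnegativity and symmetry on the whole type.
\<close>

definition norm_metric :: "'v::real_vector set \<Rightarrow> ('v \<Rightarrow> real) \<Rightarrow> 'v \<Rightarrow> 'v \<Rightarrow> real"
  where "norm_metric V N x y = (if x \<in> V \<and> y \<in> V then N (x - y) else 0)"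

lemma Metric_space_norm_metric:
  assumes "normed_space_on V N"
  shows "Metric_space V (norm_metric V N)"
proof
  have sub: "subspace V" and nonneg: "\<And>x. x \<in> V \<Longrightarrow> 0 \<le> N x"
    and zero: "\<And>x. x \<in> V \<Longrightarrow> N x = 0 \<longleftrightarrow> x = 0"
    and scale: "\<And>c x. x \<in> V \<Longrightarrow> N (c *\<^sub>R x) = \<bar>c\<bar> * N x"
    and tri: "\<And>x y. x \<in> V \<Longrightarrow> y \<in> V \<Longrightarrow> N (x + y) \<le> N x + N y"
    using assms by (auto simp: normed_space_on_def)
  note diff = subspace_diff[OF sub]
  fix x y z :: 'a
  show "0 \<le> norm_metric V N x y"
    by (simp add: norm_metric_def nonneg diff)
  show "norm_metric V N x y = norm_metric V N y x"
    using scale[of "x - y" "- 1"] by (simp add: norm_metric_def diff)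
  show "norm_metric V N x y = 0 \<longleftrightarrow> x = y" if "x \<in> V" "y \<in> V"
    using that by (simp add: norm_metric_def zero diff)
  show "norm_metric V N x z \<le> norm_metric V N x y + norm_metric V N y z"
    if "x \<in> V" "y \<in> V" "z \<in> V"
    using that tri[of "x - y" "y - z"] by (simp add: norm_metric_def diff)
qed

definition banach_space_on :: "'v::real_vector set \<Rightarrow> ('v \<Rightarrow> real) \<Rightarrow> bool"
  where "banach_space_on V N \<longleftrightarrow>
    normed_space_on V N \<and> Metric_space.mcomplete V (norm_metric V N)"

text \<open>
  A Banach lattice is a Banach space with a vector lattice order for which
  \<open>\<bar>x\<bar> \<le> \<bar>y\<bar>\<close> implies \<open>N x \<le> N y\<close>, where \<open>\<bar>x\<bar>\<close> is the join of \<open>x\<close> and \<open>- x\<close>.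
  The order relation is only considered between elements of \<open>V\<close>, and joins are formed within \<open>V\<close>.
\<close>

definition order_on_carrier :: "'v set \<Rightarrow> ('v \<Rightarrow> 'v \<Rightarrow> bool) \<Rightarrow> 'v gorder"
  where "order_on_carrier V leq = \<lparr>carrier = V, eq = (=), le = leq\<rparr>"

definition modulus_on :: "'v::real_vector set \<Rightarrow> ('v \<Rightarrow> 'v \<Rightarrow> bool) \<Rightarrow> 'v \<Rightarrow> 'v"
  where "modulus_on V leq x = x \<squnion>\<^bsub>order_on_carrier V leq\<^esub> (- x)"

definition banach_lattice_on ::
    "'v::real_vector set \<Rightarrow> ('v \<Rightarrow> real) \<Rightarrow> ('v \<Rightarrow> 'v \<Rightarrow> bool) \<Rightarrow> bool"
  where "banach_lattice_on V N leq \<longleftrightarrow>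
    banach_space_on V N \<and>
    lattice (order_on_carrier V leq) \<and>
    (\<forall>x\<in>V. \<forall>y\<in>V. \<forall>z\<in>V. leq x y \<longrightarrow> leq (x + z) (y + z)) \<and>
    (\<forall>c\<ge>0. \<forall>x\<in>V. \<forall>y\<in>V. leq x y \<longrightarrow> leq (c *\<^sub>R x) (c *\<^sub>R y)) \<and>
    (\<forall>x\<in>V. \<forall>y\<in>V. leq (modulus_on V leq x) (modulus_on V leq y) \<longrightarrow> N x \<le> N y)"

definition banach_sequence_lattice :: "(nat \<Rightarrow> real) set \<Rightarrow> ((nat \<Rightarrow> real) \<Rightarrow> real) \<Rightarrow> bool"
  where "banach_sequence_lattice Y N \<longleftrightarrow>
    banach_space_on Y N \<and>
    (\<forall>n. (\<lambda>k. if k = n then 1 else 0) \<in> Y) \<and>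
    (\<forall>f. \<forall>g\<in>Y. (\<forall>n. \<bar>f n\<bar> \<le> \<bar>g n\<bar>) \<longrightarrow> f \<in> Y \<and> N f \<le> N g)"

text \<open>The sequence spaces over a Banach space, which is the whole type \<open>'e\<close>.\<close>

definition ell :: "(nat \<Rightarrow> real) set \<Rightarrow> (nat \<Rightarrow> 'e::real_normed_vector) set"
  where "ell Y = {w. (\<lambda>j. norm (w j)) \<in> Y}"

definition ell_norm :: "((nat \<Rightarrow> real) \<Rightarrow> real) \<Rightarrow> (nat \<Rightarrow> 'e::real_normed_vector) \<Rightarrow> real"
  where "ell_norm N w = N (\<lambda>j. norm (w j))"

definition ell00 :: "(nat \<Rightarrow> real) set \<Rightarrow> (nat \<Rightarrow> 'e::real_normed_vector) set"
  where "ell00 Y = {w \<in> ell Y. \<forall>\<^sub>F j in sequentially. w j = 0}"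

definition ell0 ::
    "(nat \<Rightarrow> real) set \<Rightarrow> ((nat \<Rightarrow> real) \<Rightarrow> real) \<Rightarrow> (nat \<Rightarrow> 'e::real_normed_vector) set"
  where "ell0 Y N =
    Abstract_Topology.closure_of
      (Metric_space.mtopology (ell Y) (norm_metric (ell Y) (ell_norm N))) (ell00 Y)"

definition componentwise :: "('e \<Rightarrow> 'e \<Rightarrow> bool) \<Rightarrow> (nat \<Rightarrow> 'e) \<Rightarrow> (nat \<Rightarrow> 'e) \<Rightarrow> bool"
  where "componentwise leq v w \<longleftrightarrow> (\<forall>j. leq (v j) (w j))"

end

theory Submission
  imports Defs
begin

text \<open>
  Completeness of \<open>ell Y\<close> is tested on series: if \<open>\<Sum>w\<^sub>i\<close> converges absolutely in \<open>ell Y\<close>, then the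
  norm sequences of the \<open>w\<^sub>i\<close> form a convergent series in \<open>Y\<close>, whose remainders dominate
  those of \<open>\<Sum>w\<^sub>i\<close> coordinatewise. Lattice operations on \<open>ell Y\<close> are coordinatewise because
  \<open>norm (x \<squnion> y) \<le> norm x + norm y\<close> in \<open>E\<close>. Finally \<open>ell0 Y N = ell Y\<^sub>0\<close>, where \<open>Y\<^sub>0\<close> consists of
  the sequences in \<open>Y\<close> whose tails tend to zero in norm, and \<open>Y\<^sub>0\<close> is itself a Banach
  sequence lattice, so that everything about \<open>ell0\<close> is an instance of the result about \<open>ell\<close>.
\<close>

section \<open>Normed spaces on a carrier and the series criterion for completeness\<close>

lemma normed_space_onD:
  assumes "normed_space_on V N"
  shows "subspace V" "x \<in> V \<Longrightarrow> 0 \<le> N x" "x \<in> V \<Longrightarrow> N x = 0 \<longleftrightarrow> x = 0"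
    "x \<in> V \<Longrightarrow> N (c *\<^sub>R x) = \<bar>c\<bar> * N x"
    "x \<in> V \<Longrightarrow> y \<in> V \<Longrightarrow> N (x + y) \<le> N x + N y"
  using assms by (simp_all add: normed_space_on_def)

lemma normed_space_on_minus_commute:
  assumes V: "normed_space_on V N" and "x \<in> V" "y \<in> V"
  shows "N (x - y) = N (y - x)"
  using normed_space_onD(4)[OF V, of "x - y" "-1"] subspace_diff[OF normed_space_onD(1)[OF V]] assms
  by simp

lemma normed_space_on_sum_le:
  assumes V: "normed_space_on V N" and x: "\<And>i. i \<in> A \<Longrightarrow> x i \<in> V"
  shows "N (sum x A) \<le> (\<Sum>i\<in>A. N (x i))"
  using x
proof (induction A rule: infinite_finite_induct)
  case (insert a A)
  have "sum x A \<in> V"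
    using insert.prems by (intro subspace_sum[OF normed_space_onD(1)[OF V]]) auto
  then have "N (x a + sum x A) \<le> N (x a) + N (sum x A)"
    using normed_space_onD(5)[OF V] insert.prems by blast
  also have "\<dots> \<le> N (x a) + (\<Sum>i\<in>A. N (x i))"
    using insert by simp
  finally show ?case using insert by simp
qed (use normed_space_onD(3)[OF V, of 0] subspace_0[OF normed_space_onD(1)[OF V]] in auto)

lemma sum_fun_apply: "(\<Sum>i\<in>A. f i) x = (\<Sum>i\<in>A. f i x)"
  by (induction A rule: infinite_finite_induct) simp_all

lemma geometric_tail_le: "(\<Sum>i=m..<n. (1/2::real) ^ i) \<le> 2 * (1/2) ^ m"
proof (cases "m \<le> n")
  case True
  then have "(\<Sum>i=m..<n. (1/2::real) ^ i) = 2 * (1/2) ^ m - 2 * (1/2) ^ n"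
    by (induction n rule: dec_induct) auto
  then show ?thesis by simp
qed simp

text \<open>The partial sums are Cauchy, since a block of terms starting at \<open>m\<close> has
  norm at most \<open>2 * (1/2) ^ m\<close>. The fixed rate \<open>(1/2) ^ i\<close> stands in for
  absolute convergence; the converse below shows that this rate already detects
  completeness.\<close>

lemma banach_space_on_series_converges:
  assumes B: "banach_space_on V N" and x: "\<And>i. x i \<in> V" "\<And>i. N (x i) \<le> (1/2) ^ i"
  shows "\<exists>s\<in>V. (\<lambda>n. N (s - (\<Sum>i<n. x i))) \<longlonglongrightarrow> 0"
proof -
  have V: "normed_space_on V N" and C: "Metric_space.mcomplete V (norm_metric V N)"
    using B by (auto simp: banach_space_on_def)
  interpret M: Metric_space V "norm_metric V N" by (rule Metric_space_norm_metric[OF V])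
  define S where "S n = (\<Sum>i<n. x i)" for n
  have SV: "S n \<in> V" for n
    unfolding S_def using x by (intro subspace_sum[OF normed_space_onD(1)[OF V]]) auto
  have le: "N (S n - S m) \<le> 2 * (1/2) ^ m" if "m \<le> n" for m n
  proof -
    have "S n - S m = (\<Sum>i=m..<n. x i)"
      unfolding S_def lessThan_atLeast0 using sum_diff_nat_ivl[of 0 m n x] that by simp
    then have "N (S n - S m) \<le> (\<Sum>i=m..<n. N (x i))"
      using normed_space_on_sum_le[OF V, of "{m..<n}" x] x by simp
    also have "\<dots> \<le> (\<Sum>i=m..<n. (1/2) ^ i)" by (intro sum_mono x)
    also have "\<dots> \<le> 2 * (1/2) ^ m" by (rule geometric_tail_le)
    finally show ?thesis .
  qed
  have "M.MCauchy S"
    unfolding M.MCauchy_def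
  proof (intro conjI allI impI)
    show "range S \<subseteq> V" using SV by auto
    fix \<epsilon> :: real assume "\<epsilon> > 0"
    then obtain K where K: "(1/2::real) ^ K < \<epsilon> / 2"
      using real_arch_pow_inv[of "\<epsilon> / 2" "1/2"] by auto
    \<comment> \<open>Only \<open>m \<le> n\<close> is treated; symmetry of the metric covers the
      other case.\<close>
    have "norm_metric V N (S m) (S n) < \<epsilon>" if "K \<le> m" "m \<le> n" for m n
    proof -
      have "norm_metric V N (S m) (S n) = N (S n - S m)"
        using normed_space_on_minus_commute[OF V] SV by (simp add: norm_metric_def)
      also have "\<dots> \<le> 2 * (1/2) ^ m" by (rule le[OF that(2)])
      also have "\<dots> \<le> 2 * (1/2) ^ K" using power_decreasing[OF that(1), of "1/2::real"] by simp
      finally show ?thesis using K by simp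
    qed
    then show "\<exists>K. \<forall>m n. K \<le> m \<longrightarrow> K \<le> n \<longrightarrow> norm_metric V N (S m) (S n) < \<epsilon>"
      by (metis M.commute nle_le)
  qed
  then obtain s where s: "limitin M.mtopology S s sequentially"
    using C M.mcomplete_def by blast
  then have "s \<in> V" and lim: "(\<lambda>n. norm_metric V N (S n) s) \<longlonglongrightarrow> 0"
    using M.limit_metric_sequentially[of S s] M.limitin_metric_dist_null[of S s sequentially] by auto
  moreover have "norm_metric V N (S n) s = N (s - S n)" for n
    using normed_space_on_minus_commute[OF V] SV \<open>s \<in> V\<close> by (simp add: norm_metric_def)
  ultimately show ?thesis by (auto simp: S_def)
qed

text \<open>A Cauchy sequence has a subsequence whose consecutive differences have norms below
  \<open>(1/2) ^ i\<close>. The series of these differences telescopes, so the subsequence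
  converges, and with it the whole Cauchy sequence.\<close>

lemma banach_space_onI_series:
  assumes V: "normed_space_on V N"
    and conv: "\<And>x. (\<And>i::nat. x i \<in> V) \<Longrightarrow> (\<And>i. N (x i) \<le> (1/2) ^ i) \<Longrightarrow>
      \<exists>s\<in>V. (\<lambda>n. N (s - (\<Sum>i<n. x i))) \<longlonglongrightarrow> 0"
  shows "banach_space_on V N"
proof -
  interpret M: Metric_space V "norm_metric V N" by (rule Metric_space_norm_metric[OF V])
  note sub = normed_space_onD(1)[OF V]
  have "\<exists>l. limitin M.mtopology \<sigma> l sequentially" if \<sigma>: "M.MCauchy \<sigma>" for \<sigma>
  proof -
    have \<sigma>V: "\<sigma> n \<in> V" for n using \<sigma> by (auto simp: M.MCauchy_def)
    have "\<exists>K. \<forall>m n. K \<le> m \<longrightarrow> K \<le> n \<longrightarrow> norm_metric V N (\<sigma> m) (\<sigma> n) < (1/2) ^ i" for i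
      using \<sigma> by (simp add: M.MCauchy_def)
    then obtain K where K: "\<And>i m n. K i \<le> m \<Longrightarrow> K i \<le> n \<Longrightarrow> norm_metric V N (\<sigma> m) (\<sigma> n) < (1/2) ^ i"
      by metis
    \<comment> \<open>The maximum makes \<open>r\<close> strictly increasing and keeps
      \<open>r i\<close> beyond the threshold \<open>K i\<close>.\<close>
    define r where "r = rec_nat (K 0) (\<lambda>i k. max (Suc k) (K (Suc i)))"
    have r: "r i < r (Suc i)" "K i \<le> r i" for i
      unfolding r_def by (simp_all, cases i) auto
    have r_mono: "strict_mono r" using r by (simp add: strict_mono_Suc_iff)
    define x where "x i = \<sigma> (r (Suc i)) - \<sigma> (r i)" for i
    have "N (x i) \<le> (1/2) ^ i" for i
      using K[of i "r (Suc i)" "r i"] r[of i] \<sigma>V by (simp add: norm_metric_def x_def)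
    moreover have "x i \<in> V" for i
      using \<sigma>V by (simp add: x_def subspace_diff[OF sub])
    ultimately obtain s where s: "s \<in> V" "(\<lambda>n. N (s - (\<Sum>i<n. x i))) \<longlonglongrightarrow> 0"
      using conv by blast
    \<comment> \<open>The telescoping sum lacks the initial term \<open>\<sigma> (r 0)\<close>, so
      the subsequence tends to \<open>s + \<sigma> (r 0)\<close>.\<close>
    have tel: "(\<Sum>i<n. x i) = \<sigma> (r n) - \<sigma> (r 0)" for n
      unfolding x_def by (rule sum_lessThan_telescope)
    have l: "s + \<sigma> (r 0) \<in> V" using s \<sigma>V by (simp add: subspace_add[OF sub])
    have "norm_metric V N (\<sigma> (r n)) (s + \<sigma> (r 0)) = N (s - (\<Sum>i<n. x i))" for n
      using normed_space_on_minus_commute[OF V, of "\<sigma> (r n)" "s + \<sigma> (r 0)"] l \<sigma>V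
      by (simp add: norm_metric_def tel algebra_simps)
    then have "limitin M.mtopology (\<sigma> \<circ> r) (s + \<sigma> (r 0)) sequentially"
      using s l \<sigma>V by (simp add: M.limitin_metric_dist_null)
    then show ?thesis
      using M.MCauchy_convergent_subsequence[OF \<sigma> r_mono] by blast
  qed
  then show ?thesis
    using V by (simp add: banach_space_on_def M.mcomplete_def)
qed

section \<open>Coordinates in a Banach sequence lattice and completeness of
  \<open>ell Y\<close>\<close>

context
  fixes Y :: "(nat \<Rightarrow> real) set" and N :: "(nat \<Rightarrow> real) \<Rightarrow> real"
  assumes Y: "banach_sequence_lattice Y N"
begin

lemma sequence_lattice_banach: "banach_space_on Y N"
  and sequence_lattice_normed: "normed_space_on Y N"
  and sequence_lattice_unit: "(\<lambda>k. if k = n then 1 else 0) \<in> Y"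
  and sequence_lattice_solid: "g \<in> Y \<Longrightarrow> (\<And>n. \<bar>f n\<bar> \<le> \<bar>g n\<bar>) \<Longrightarrow> f \<in> Y"
  and sequence_lattice_mono: "g \<in> Y \<Longrightarrow> (\<And>n. \<bar>f n\<bar> \<le> \<bar>g n\<bar>) \<Longrightarrow> N f \<le> N g"
  using Y by (simp_all add: banach_sequence_lattice_def banach_space_on_def)

text \<open>The multiple \<open>f j\<close> of the unit sequence at \<open>j\<close> is dominated by
  \<open>f\<close>, and homogeneity computes its norm. Since unit sequences have positive norm, the
  coordinate functionals are continuous.\<close>

lemma sequence_lattice_coord_le:
  assumes "f \<in> Y"
  shows "\<bar>f j\<bar> * N (\<lambda>k. if k = j then 1 else 0) \<le> N f"
proof -
  have "\<bar>f j\<bar> * N (\<lambda>k. if k = j then 1 else 0) = N (f j *\<^sub>R (\<lambda>k. if k = j then 1 else 0))"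
    by (rule normed_space_onD(4)[OF sequence_lattice_normed sequence_lattice_unit, symmetric])
  also have "\<dots> \<le> N f"
    by (rule sequence_lattice_mono[OF assms]) (simp add: scaleR_fun_def)
  finally show ?thesis .
qed

lemma sequence_lattice_unit_pos: "0 < N (\<lambda>k. if k = j then 1 else 0)"
proof -
  have "(\<lambda>k. if k = j then 1 else 0) \<noteq> (0::nat \<Rightarrow> real)"
    by (auto simp: fun_eq_iff)
  then show ?thesis
    using normed_space_onD(2,3)[OF sequence_lattice_normed sequence_lattice_unit[of j]]
    by linarith
qed

text \<open>Division by the norm of the unit sequence at \<open>j\<close> bounds the
  \<open>j\<close>-th coordinate by a null sequence. This lets limits in norm be identified
  coordinate by coordinate.\<close>

lemma sequence_lattice_coord_tendsto:
  assumes "\<And>n. f n \<in> Y" "(\<lambda>n. N (f n)) \<longlonglongrightarrow> 0"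
  shows "(\<lambda>n. f n j) \<longlonglongrightarrow> 0"
proof -
  let ?c = "N (\<lambda>k. if k = j then 1 else 0)"
  have "norm (f n j) \<le> N (f n) / ?c" for n
    using sequence_lattice_coord_le[OF assms(1)] sequence_lattice_unit_pos
    by (simp add: pos_le_divide_eq)
  moreover have "(\<lambda>n. N (f n) / ?c) \<longlonglongrightarrow> 0"
    using tendsto_divide[OF assms(2) tendsto_const[of ?c]] sequence_lattice_unit_pos[of j] by simp
  ultimately show ?thesis
    by (rule Lim_null_comparison[OF always_eventually, rule_format])
qed

text \<open>A sequence \<open>g\<close> dominating norms is nonnegative, so solidity of
  \<open>Y\<close> applies to the sequence of norms. This is the main way to place a sequence in
  \<open>ell Y\<close> and to bound its norm.\<close>

lemma ell_solid:
  assumes "g \<in> Y" "\<And>j. norm (w j) \<le> g j"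
  shows "w \<in> ell Y" "ell_norm N w \<le> N g"
proof -
  have "\<bar>norm (w j)\<bar> \<le> \<bar>g j\<bar>" for j using assms(2)[of j] by simp
  then show "w \<in> ell Y" "ell_norm N w \<le> N g"
    using sequence_lattice_solid[OF assms(1), of "\<lambda>j. norm (w j)"]
      sequence_lattice_mono[OF assms(1), of "\<lambda>j. norm (w j)"]
    by (auto simp: ell_def ell_norm_def)
qed

text \<open>The norms of \<open>x + y\<close> are dominated by the sum of the two norm sequences, so
  closure under addition and the triangle inequality follow from solidity and the triangle
  inequality of \<open>Y\<close>.\<close>

lemma normed_space_on_ell: "normed_space_on (ell Y :: (nat \<Rightarrow> 'e::real_normed_vector) set) (ell_norm N)"
proof -
  note V = normed_space_onD[OF sequence_lattice_normed]
  have add: "x + y \<in> ell Y" "ell_norm N (x + y) \<le> ell_norm N x + ell_norm N y"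
    if "x \<in> ell Y" "y \<in> ell Y" for x y :: "nat \<Rightarrow> 'e"
  proof -
    let ?g = "(\<lambda>j. norm (x j)) + (\<lambda>j. norm (y j))"
    have g: "?g \<in> Y" using that subspace_add[OF V(1)] by (simp add: ell_def)
    have le: "norm ((x + y) j) \<le> ?g j" for j by (simp add: norm_triangle_ineq)
    show "x + y \<in> ell Y" by (rule ell_solid[OF g le])
    have "ell_norm N (x + y) \<le> N ?g" by (rule ell_solid[OF g le])
    also have "\<dots> \<le> ell_norm N x + ell_norm N y"
      using V(5) that by (simp add: ell_def ell_norm_def)
    finally show "ell_norm N (x + y) \<le> ell_norm N x + ell_norm N y" .
  qed
  have norm_scale: "(\<lambda>j. norm ((c *\<^sub>R x) j)) = \<bar>c\<bar> *\<^sub>R (\<lambda>j. norm (x j))" for c and x :: "nat \<Rightarrow> 'e"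
    by (simp add: scaleR_fun_def)
  have "subspace (ell Y :: (nat \<Rightarrow> 'e) set)"
    unfolding subspace_def
  proof (intro conjI allI ballI)
    show "(0 :: nat \<Rightarrow> 'e) \<in> ell Y"
      using subspace_0[OF V(1)] by (simp add: ell_def zero_fun_def)
    show "c *\<^sub>R x \<in> ell Y" if "x \<in> ell Y" for c and x :: "nat \<Rightarrow> 'e"
      using subspace_scale[OF V(1)] that by (simp add: ell_def norm_scale)
  qed (rule add)
  moreover have "ell_norm N x = 0 \<longleftrightarrow> x = 0" if "x \<in> ell Y" for x :: "nat \<Rightarrow> 'e"
    using that V(3)[of "\<lambda>j. norm (x j)"] by (simp add: ell_def ell_norm_def fun_eq_iff)
  moreover have "ell_norm N (c *\<^sub>R x) = \<bar>c\<bar> * ell_norm N x" if "x \<in> ell Y" for c and x :: "nat \<Rightarrow> 'e"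
    using that V(4)[of "\<lambda>j. norm (x j)" "\<bar>c\<bar>"] unfolding ell_norm_def norm_scale
    by (simp add: ell_def)
  ultimately show ?thesis
    unfolding normed_space_on_def using add V(2) by (auto simp: ell_def ell_norm_def)
qed

lemma banach_space_on_ell: "banach_space_on (ell Y :: (nat \<Rightarrow> 'e::banach) set) (ell_norm N)"
proof (rule banach_space_onI_series[OF normed_space_on_ell])
  fix w :: "nat \<Rightarrow> nat \<Rightarrow> 'e"
  assume w: "\<And>i. w i \<in> ell Y" "\<And>i. ell_norm N (w i) \<le> (1/2) ^ i"
  let ?a = "\<lambda>i j. norm (w i j)"
  \<comment> \<open>By definition of \<open>ell_norm\<close>, the norm sequences satisfy the same
    geometric bound in \<open>Y\<close>, so their series has a limit there.\<close>
  obtain y where y: "y \<in> Y" "(\<lambda>n. N (y - (\<Sum>i<n. ?a i))) \<longlonglongrightarrow> 0"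
    using banach_space_on_series_converges[OF sequence_lattice_banach, of ?a] w
    by (auto simp: ell_def ell_norm_def)
  have remY: "y - (\<Sum>i<n. ?a i) \<in> Y" for n
    using y w normed_space_onD(1)[OF sequence_lattice_normed]
    by (intro subspace_diff subspace_sum) (auto simp: ell_def)
  \<comment> \<open>Norm convergence in \<open>Y\<close> forces coordinatewise convergence, so
    \<open>y j\<close> is the sum of the norms at coordinate \<open>j\<close>.\<close>
  have sums: "(\<lambda>i. norm (w i j)) sums y j" for j
  proof -
    have "(\<lambda>n. y j - (y - (\<Sum>i<n. ?a i)) j) \<longlonglongrightarrow> y j - 0"
      by (intro tendsto_diff tendsto_const sequence_lattice_coord_tendsto[OF remY y(2)])
    then show ?thesis by (simp add: sums_def sum_fun_apply)
  qed
  define s where "s j = (\<Sum>i. w i j)" for j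
  \<comment> \<open>Completeness of \<open>'e\<close> enters here: absolute convergence at each
    coordinate makes \<open>s j\<close> a true sum, and its remainder is at most the remainder of
    the norms.\<close>
  have rem: "norm ((s - (\<Sum>i<n. w i)) j) \<le> (y - (\<Sum>i<n. ?a i)) j" for n j
  proof -
    have sm: "summable (\<lambda>i. norm (w i j))" using sums by (rule sums_summable)
    have "(s - (\<Sum>i<n. w i)) j = (\<Sum>i. w (i + n) j)"
      using suminf_minus_initial_segment[OF summable_norm_cancel[OF sm], of n]
      by (simp add: s_def sum_fun_apply)
    also have "norm \<dots> \<le> (\<Sum>i. norm (w (i + n) j))"
      by (intro summable_norm summable_ignore_initial_segment[OF sm, of n])
    also have "\<dots> = (y - (\<Sum>i<n. ?a i)) j"
      using suminf_minus_initial_segment[OF sm, of n] sums_unique[OF sums]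
      by (simp add: sum_fun_apply)
    finally show ?thesis .
  qed
  \<comment> \<open>For \<open>n = 0\<close> the partial sums are empty.\<close>
  have "norm (s j) \<le> y j" for j using rem[of 0 j] by simp
  then have "s \<in> ell Y" by (rule ell_solid[OF y(1)])
  moreover have "(\<lambda>n. ell_norm N (s - (\<Sum>i<n. w i))) \<longlonglongrightarrow> 0"
  proof (rule tendsto_sandwich[OF _ _ tendsto_const y(2)])
    show "\<forall>\<^sub>F n in sequentially. 0 \<le> ell_norm N (s - (\<Sum>i<n. w i))"
      by (rule always_eventually, rule allI, rule normed_space_onD(2)[OF normed_space_on_ell],
          rule ell_solid(1)[OF remY rem])
    show "\<forall>\<^sub>F n in sequentially. ell_norm N (s - (\<Sum>i<n. w i)) \<le> N (y - (\<Sum>i<n. ?a i))"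
      by (rule always_eventually, rule allI, rule ell_solid(2)[OF remY rem])
  qed
  ultimately show "\<exists>s\<in>ell Y. (\<lambda>n. ell_norm N (s - (\<Sum>i<n. w i))) \<longlonglongrightarrow> 0" by blast
qed

end

section \<open>Vanishing tails and the description of \<open>ell0\<close>\<close>

definition tail_seq :: "nat \<Rightarrow> (nat \<Rightarrow> 'e::zero) \<Rightarrow> nat \<Rightarrow> 'e"
  where "tail_seq n f = (\<lambda>k. if k < n then 0 else f k)"

text \<open>This is the closure in \<open>Y\<close> of the finitely supported sequences. One small
  tail for each \<open>\<epsilon>\<close> expresses convergence of the tails to zero, because their
  norms decrease in \<open>n\<close>.\<close>

definition vanishing_tails :: "(nat \<Rightarrow> real) set \<Rightarrow> ((nat \<Rightarrow> real) \<Rightarrow> real) \<Rightarrow> (nat \<Rightarrow> real) set"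
  where "vanishing_tails Y N = {f \<in> Y. \<forall>\<epsilon>>0. \<exists>n. N (tail_seq n f) < \<epsilon>}"

context
  fixes Y :: "(nat \<Rightarrow> real) set" and N :: "(nat \<Rightarrow> real) \<Rightarrow> real"
  assumes Y: "banach_sequence_lattice Y N"
begin

lemma tail_seq_in: "f \<in> Y \<Longrightarrow> tail_seq n f \<in> Y"
  by (rule sequence_lattice_solid[OF Y]) (auto simp: tail_seq_def)

lemma tail_seq_norm_antimono: "f \<in> Y \<Longrightarrow> m \<le> n \<Longrightarrow> N (tail_seq n f) \<le> N (tail_seq m f)"
  by (rule sequence_lattice_mono[OF Y tail_seq_in]) (auto simp: tail_seq_def)

lemma vanishing_tails_solid:
  assumes "g \<in> vanishing_tails Y N" "\<And>n. \<bar>f n\<bar> \<le> \<bar>g n\<bar>"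
  shows "f \<in> vanishing_tails Y N"
proof -
  have g: "g \<in> Y" using assms by (simp add: vanishing_tails_def)
  have "N (tail_seq n f) \<le> N (tail_seq n g)" for n
    by (rule sequence_lattice_mono[OF Y tail_seq_in[OF g]]) (simp add: tail_seq_def assms)
  then show ?thesis
    using assms sequence_lattice_solid[OF Y g, of f]
    unfolding vanishing_tails_def by (blast intro: le_less_trans)
qed

lemma subspace_vanishing_tails: "subspace (vanishing_tails Y N)"
  unfolding subspace_def
proof (intro conjI allI ballI)
  note V = normed_space_onD[OF sequence_lattice_normed[OF Y]]
  have "tail_seq n 0 = (0 :: nat \<Rightarrow> real)" "N 0 = 0" for n
    using V(3)[of 0] subspace_0[OF V(1)] by (auto simp: tail_seq_def fun_eq_iff)
  then show "0 \<in> vanishing_tails Y N"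
    using subspace_0[OF V(1)] by (simp add: vanishing_tails_def)
  fix x assume x: "x \<in> vanishing_tails Y N"
  show "c *\<^sub>R x \<in> vanishing_tails Y N" for c
  proof -
    have "N (tail_seq n (c *\<^sub>R x)) = \<bar>c\<bar> * N (tail_seq n x)" for n
    proof -
      have "tail_seq n (c *\<^sub>R x) = c *\<^sub>R tail_seq n x"
        by (auto simp: tail_seq_def scaleR_fun_def)
      then show ?thesis using x V(4) tail_seq_in by (simp add: vanishing_tails_def)
    qed
    moreover have "\<exists>n. \<bar>c\<bar> * N (tail_seq n x) < \<epsilon>" if "\<epsilon> > 0" for \<epsilon>
    proof (cases "c = 0")
      case False
      then have "\<epsilon> / \<bar>c\<bar> > 0" using that by simp
      then obtain n where "N (tail_seq n x) < \<epsilon> / \<bar>c\<bar>" using x unfolding vanishing_tails_def by blast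
      then show ?thesis using False by (auto simp: pos_less_divide_eq mult.commute)
    qed (use that in simp)
    ultimately show ?thesis
      using x subspace_scale[OF V(1)] by (simp add: vanishing_tails_def)
  qed
  show "x + y \<in> vanishing_tails Y N" if y: "y \<in> vanishing_tails Y N" for y
  proof -
    have xy: "x \<in> Y" "y \<in> Y" using x y by (auto simp: vanishing_tails_def)
    have "\<exists>n. N (tail_seq n (x + y)) < \<epsilon>" if "\<epsilon> > 0" for \<epsilon>
    proof -
      from that have "\<epsilon> / 2 > 0" by simp
      then obtain m n where mn: "N (tail_seq m x) < \<epsilon> / 2" "N (tail_seq n y) < \<epsilon> / 2"
        using x y unfolding vanishing_tails_def by blast
      \<comment> \<open>Both tails remain small from the later of the two indices on.\<close>
      let ?k = "max m n"
      have "tail_seq ?k (x + y) = tail_seq ?k x + tail_seq ?k y"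
        by (auto simp: tail_seq_def)
      then have "N (tail_seq ?k (x + y)) \<le> N (tail_seq ?k x) + N (tail_seq ?k y)"
        using V(5) xy tail_seq_in by simp
      also have "\<dots> \<le> N (tail_seq m x) + N (tail_seq n y)"
        using xy by (intro add_mono tail_seq_norm_antimono) auto
      finally show ?thesis using mn by (intro exI[of _ ?k]) simp
    qed
    then show ?thesis using xy subspace_add[OF V(1)] by (simp add: vanishing_tails_def)
  qed
qed

lemma normed_space_on_vanishing_tails: "normed_space_on (vanishing_tails Y N) N"
  using sequence_lattice_normed[OF Y] subspace_vanishing_tails
  unfolding normed_space_on_def by (auto simp: vanishing_tails_def)

text \<open>A tail of \<open>s\<close> is the sum of a tail of \<open>s - f\<close>, dominated by
  \<open>s - f\<close> itself, and a tail of \<open>f\<close>; each part costs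
  \<open>\<epsilon> / 2\<close>.\<close>

lemma vanishing_tails_closed:
  assumes s: "s \<in> Y" and approx: "\<And>\<epsilon>. \<epsilon> > 0 \<Longrightarrow> \<exists>f\<in>vanishing_tails Y N. N (s - f) < \<epsilon>"
  shows "s \<in> vanishing_tails Y N"
proof -
  note V = normed_space_onD[OF sequence_lattice_normed[OF Y]]
  have "\<exists>n. N (tail_seq n s) < \<epsilon>" if "\<epsilon> > 0" for \<epsilon>
  proof -
    from that have "\<epsilon> / 2 > 0" by simp
    then obtain f n where f: "f \<in> vanishing_tails Y N" "N (s - f) < \<epsilon> / 2" "N (tail_seq n f) < \<epsilon> / 2"
      using approx unfolding vanishing_tails_def by blast
    then have fY: "f \<in> Y" by (simp add: vanishing_tails_def)
    have d: "s - f \<in> Y" using s fY by (simp add: subspace_diff[OF V(1)])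
    have "tail_seq n s = tail_seq n (s - f) + tail_seq n f"
      by (auto simp: tail_seq_def)
    then have "N (tail_seq n s) \<le> N (tail_seq n (s - f)) + N (tail_seq n f)"
      using V(5) tail_seq_in d fY by simp
    also have "N (tail_seq n (s - f)) \<le> N (s - f)"
      by (rule sequence_lattice_mono[OF Y d]) (simp add: tail_seq_def)
    finally show ?thesis using f by (intro exI[of _ n]) simp
  qed
  then show ?thesis using s by (simp add: vanishing_tails_def)
qed

text \<open>Completeness is inherited through closedness: a geometrically bounded series has a limit
  in \<open>Y\<close>, and its partial sums stay in the subspace. Solidity holds because domination
  passes to tails.\<close>

lemma banach_sequence_lattice_vanishing_tails: "banach_sequence_lattice (vanishing_tails Y N) N"
  unfolding banach_sequence_lattice_def
proof (intro conjI allI ballI impI)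
  have subY: "vanishing_tails Y N \<subseteq> Y" by (auto simp: vanishing_tails_def)
  show "banach_space_on (vanishing_tails Y N) N"
  proof (rule banach_space_onI_series[OF normed_space_on_vanishing_tails])
    fix x assume x: "\<And>i::nat. x i \<in> vanishing_tails Y N" "\<And>i. N (x i) \<le> (1/2) ^ i"
    obtain s where s: "s \<in> Y" "(\<lambda>n. N (s - (\<Sum>i<n. x i))) \<longlonglongrightarrow> 0"
      using banach_space_on_series_converges[OF sequence_lattice_banach[OF Y], of x] x subY by blast
    have "s \<in> vanishing_tails Y N"
    proof (rule vanishing_tails_closed[OF s(1)])
      fix \<epsilon> :: real assume "\<epsilon> > 0"
      then obtain n where "N (s - (\<Sum>i<n. x i)) < \<epsilon>"
        using order_tendstoD(2)[OF s(2)] by (auto simp: eventually_sequentially)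
      moreover have "(\<Sum>i<n. x i) \<in> vanishing_tails Y N"
        by (rule subspace_sum[OF subspace_vanishing_tails x(1)])
      ultimately show "\<exists>f\<in>vanishing_tails Y N. N (s - f) < \<epsilon>" by blast
    qed
    then show "\<exists>s\<in>vanishing_tails Y N. (\<lambda>n. N (s - (\<Sum>i<n. x i))) \<longlonglongrightarrow> 0"
      using s by blast
  qed
  show "(\<lambda>k. if k = n then 1 else 0) \<in> vanishing_tails Y N" for n
  proof -
    \<comment> \<open>\<open>tail_seq n\<close> still keeps the entry at \<open>n\<close>, so the
      cut is made at \<open>Suc n\<close>.\<close>
    have "tail_seq (Suc n) (\<lambda>k. if k = n then 1 else 0) = (0 :: nat \<Rightarrow> real)"
      by (auto simp: tail_seq_def)
    moreover have "N 0 = 0"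
      using normed_space_onD(1,3)[OF sequence_lattice_normed[OF Y]] subspace_0 by blast
    ultimately show ?thesis
      using sequence_lattice_unit[OF Y, of n]
      by (auto simp: vanishing_tails_def intro!: exI[of _ "Suc n"])
  qed
  fix f g assume g: "g \<in> vanishing_tails Y N" and le: "\<forall>n. \<bar>f n\<bar> \<le> \<bar>g n\<bar>"
  show "f \<in> vanishing_tails Y N" using vanishing_tails_solid[OF g] le by blast
  show "N f \<le> N g" using sequence_lattice_mono[OF Y, of g f] g le subY by blast
qed

text \<open>Truncations are best approximations. If \<open>v\<close> is zero from \<open>n\<close>
  on, then \<open>w - v\<close> dominates the tail of \<open>w\<close> at \<open>n\<close>; cutting
  \<open>w\<close> off at \<open>n\<close> leaves exactly that tail as the error.\<close>

lemma ell0_eq_ell_vanishing_tails: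
  "ell0 Y N = (ell (vanishing_tails Y N) :: (nat \<Rightarrow> 'e::real_normed_vector) set)"
proof -
  let ?E = "ell Y :: (nat \<Rightarrow> 'e) set"
  note V = normed_space_on_ell[OF Y, where ?'e = 'e]
  interpret M: Metric_space ?E "norm_metric ?E (ell_norm N)"
    by (rule Metric_space_norm_metric[OF V])
  \<comment> \<open>\<open>ell00 Y\<close> lies in \<open>?E\<close>, so the default value 0 of
    \<open>norm_metric\<close> off the carrier never enters.\<close>
  have "w \<in> ell0 Y N \<longleftrightarrow> w \<in> ?E \<and> (\<forall>r>0. \<exists>v\<in>ell00 Y. ell_norm N (w - v) < r)" for w :: "nat \<Rightarrow> 'e"
    unfolding ell0_def M.metric_closure_of by (auto simp: norm_metric_def ell00_def)
  moreover have "(\<exists>v\<in>ell00 Y. ell_norm N (w - v) < r) \<longleftrightarrow> (\<exists>n. N (tail_seq n (\<lambda>j. norm (w j))) < r)"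
    if w: "w \<in> ?E" for w r
  proof
    assume "\<exists>v\<in>ell00 Y. ell_norm N (w - v) < r"
    then obtain v n where v: "v \<in> ?E" "ell_norm N (w - v) < r" "\<And>j. j \<ge> n \<Longrightarrow> v j = 0"
      by (auto simp: ell00_def eventually_sequentially)
    have "w - v \<in> ?E" using w v subspace_diff normed_space_onD(1)[OF V] by blast
    then have "N (tail_seq n (\<lambda>j. norm (w j))) \<le> ell_norm N (w - v)"
      unfolding ell_norm_def
      by (intro sequence_lattice_mono[OF Y]) (auto simp: tail_seq_def ell_def v)
    then show "\<exists>n. N (tail_seq n (\<lambda>j. norm (w j))) < r" using v by (meson le_less_trans)
  next
    assume "\<exists>n. N (tail_seq n (\<lambda>j. norm (w j))) < r"
    then obtain n where n: "N (tail_seq n (\<lambda>j. norm (w j))) < r" by blast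
    \<comment> \<open>The witness \<open>w - tail_seq n w\<close> is \<open>w\<close> restricted to
      the coordinates below \<open>n\<close>.\<close>
    have "(\<lambda>j. norm ((w - tail_seq n w) j)) \<in> Y"
      by (rule sequence_lattice_solid[OF Y, of "\<lambda>j. norm (w j)"]) (use w in \<open>auto simp: ell_def tail_seq_def\<close>)
    then have "w - tail_seq n w \<in> ell00 Y"
      by (auto simp: ell00_def ell_def tail_seq_def eventually_sequentially intro!: exI[of _ n])
    moreover have "(\<lambda>j. norm ((w - (w - tail_seq n w)) j)) = tail_seq n (\<lambda>j. norm (w j))"
      by (auto simp: tail_seq_def)
    ultimately show "\<exists>v\<in>ell00 Y. ell_norm N (w - v) < r"
      using n unfolding ell_norm_def by metis
  qed
  ultimately show ?thesis
    by (auto simp: ell_def vanishing_tails_def)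
qed

end

section \<open>Lattices on a carrier in terms of the order relation\<close>

lemma least_Upper_order_on_carrier:
  assumes "x \<in> V" "y \<in> V"
  shows "least (order_on_carrier V leq) s (Upper (order_on_carrier V leq) {x, y}) \<longleftrightarrow>
    s \<in> V \<and> leq x s \<and> leq y s \<and> (\<forall>u\<in>V. leq x u \<longrightarrow> leq y u \<longrightarrow> leq s u)"
  using assms unfolding least_def Upper_def order_on_carrier_def by auto

lemma greatest_Lower_order_on_carrier:
  assumes "x \<in> V" "y \<in> V"
  shows "greatest (order_on_carrier V leq) s (Lower (order_on_carrier V leq) {x, y}) \<longleftrightarrow>
    s \<in> V \<and> leq s x \<and> leq s y \<and> (\<forall>u\<in>V. leq u x \<longrightarrow> leq u y \<longrightarrow> leq u s)"
  using assms unfolding greatest_def Lower_def order_on_carrier_def by auto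

lemma partial_order_order_on_carrier_iff:
  "partial_order (order_on_carrier V leq) \<longleftrightarrow>
    (\<forall>x\<in>V. leq x x) \<and> (\<forall>x\<in>V. \<forall>y\<in>V. leq x y \<longrightarrow> leq y x \<longrightarrow> x = y) \<and>
    (\<forall>x\<in>V. \<forall>y\<in>V. \<forall>z\<in>V. leq x y \<longrightarrow> leq y z \<longrightarrow> leq x z)"
proof
  assume "partial_order (order_on_carrier V leq)"
  then interpret partial_order "order_on_carrier V leq" .
  show "(\<forall>x\<in>V. leq x x) \<and> (\<forall>x\<in>V. \<forall>y\<in>V. leq x y \<longrightarrow> leq y x \<longrightarrow> x = y) \<and>
    (\<forall>x\<in>V. \<forall>y\<in>V. \<forall>z\<in>V. leq x y \<longrightarrow> leq y z \<longrightarrow> leq x z)"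
    using le_refl le_antisym le_trans by (simp add: order_on_carrier_def)
next
  assume *: "(\<forall>x\<in>V. leq x x) \<and> (\<forall>x\<in>V. \<forall>y\<in>V. leq x y \<longrightarrow> leq y x \<longrightarrow> x = y) \<and>
    (\<forall>x\<in>V. \<forall>y\<in>V. \<forall>z\<in>V. leq x y \<longrightarrow> leq y z \<longrightarrow> leq x z)"
  show "partial_order (order_on_carrier V leq)"
    by (unfold_locales; simp add: order_on_carrier_def; use * in meson)
qed

text \<open>Trades \<open>Upper\<close> and \<open>Lower\<close> for quantifiers over
  \<open>V\<close>, the form in which the lattice axioms are used for \<open>'e\<close> and verified
  for \<open>ell Y\<close>.\<close>

lemma lattice_order_on_carrier_iff:
  "lattice (order_on_carrier V leq) \<longleftrightarrow>
    partial_order (order_on_carrier V leq) \<and>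
    (\<forall>x\<in>V. \<forall>y\<in>V. \<exists>s\<in>V. leq x s \<and> leq y s \<and> (\<forall>u\<in>V. leq x u \<longrightarrow> leq y u \<longrightarrow> leq s u)) \<and>
    (\<forall>x\<in>V. \<forall>y\<in>V. \<exists>s\<in>V. leq s x \<and> leq s y \<and> (\<forall>u\<in>V. leq u x \<longrightarrow> leq u y \<longrightarrow> leq u s))"
    (is "_ \<longleftrightarrow> ?R")
proof
  assume "lattice (order_on_carrier V leq)"
  then interpret lattice "order_on_carrier V leq" .
  have car: "carrier (order_on_carrier V leq) = V" by (simp add: order_on_carrier_def)
  have "\<exists>s\<in>V. leq x s \<and> leq y s \<and> (\<forall>u\<in>V. leq x u \<longrightarrow> leq y u \<longrightarrow> leq s u)" if "x \<in> V" "y \<in> V" for x y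
    using sup_of_two_exists[of x y] least_Upper_order_on_carrier[OF that, of leq] that
    unfolding car by blast
  moreover have "\<exists>s\<in>V. leq s x \<and> leq s y \<and> (\<forall>u\<in>V. leq u x \<longrightarrow> leq u y \<longrightarrow> leq u s)" if "x \<in> V" "y \<in> V" for x y
    using inf_of_two_exists[of x y] greatest_Lower_order_on_carrier[OF that, of leq] that
    unfolding car by blast
  ultimately show ?R using partial_order_axioms by blast
next
  assume R: ?R
  then interpret partial_order "order_on_carrier V leq" by blast
  have car: "carrier (order_on_carrier V leq) = V" by (simp add: order_on_carrier_def)
  show "lattice (order_on_carrier V leq)"
  proof
    fix x y assume "x \<in> carrier (order_on_carrier V leq)" "y \<in> carrier (order_on_carrier V leq)"
    then have xy: "x \<in> V" "y \<in> V" by (simp_all add: car)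
    show "\<exists>s. least (order_on_carrier V leq) s (Upper (order_on_carrier V leq) {x, y})"
      unfolding least_Upper_order_on_carrier[OF xy] using R xy by blast
    show "\<exists>s. greatest (order_on_carrier V leq) s (Lower (order_on_carrier V leq) {x, y})"
      unfolding greatest_Lower_order_on_carrier[OF xy] using R xy by blast
  qed
qed

text \<open>The join is a Hilbert choice of a least upper bound; uniqueness of least elements in a
  partial order pins it down.\<close>

lemma join_order_on_carrier_eqI:
  assumes "partial_order (order_on_carrier V leq)" "x \<in> V" "y \<in> V"
    and "s \<in> V" "leq x s" "leq y s" "\<And>u. u \<in> V \<Longrightarrow> leq x u \<Longrightarrow> leq y u \<Longrightarrow> leq s u"
  shows "x \<squnion>\<^bsub>order_on_carrier V leq\<^esub> y = s"
proof -
  interpret partial_order "order_on_carrier V leq" by (rule assms)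
  have s: "least (order_on_carrier V leq) s (Upper (order_on_carrier V leq) {x, y})"
    using assms by (simp add: least_Upper_order_on_carrier)
  have "(SOME z. least (order_on_carrier V leq) z (Upper (order_on_carrier V leq) {x, y})) = s"
    by (rule some_equality[where P = "\<lambda>z. least (order_on_carrier V leq) z (Upper (order_on_carrier V leq) {x, y})"])
      (use s least_unique in blast)+
  then show ?thesis by (simp add: join_def sup_def)
qed

section \<open>Modulus, join and norm in a Banach lattice\<close>

context
  fixes leq :: "'e::real_normed_vector \<Rightarrow> 'e \<Rightarrow> bool"
  assumes E: "banach_lattice_on UNIV norm leq"
begin

lemma banach_lattice_lattice: "lattice (order_on_carrier UNIV leq)"
  and banach_lattice_partial_order: "partial_order (order_on_carrier UNIV leq)"
  and banach_lattice_add: "leq x y \<Longrightarrow> leq (x + z) (y + z)"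
  and banach_lattice_scale: "0 \<le> c \<Longrightarrow> leq x y \<Longrightarrow> leq (c *\<^sub>R x) (c *\<^sub>R y)"
  and banach_lattice_norm: "leq (modulus_on UNIV leq x) (modulus_on UNIV leq y) \<Longrightarrow> norm x \<le> norm y"
proof -
  show L: "lattice (order_on_carrier UNIV leq)"
    using E unfolding banach_lattice_on_def by (elim conjE)
  show "partial_order (order_on_carrier UNIV leq)"
    using L unfolding lattice_order_on_carrier_iff by (elim conjE)
qed (use E in \<open>simp_all add: banach_lattice_on_def\<close>)

lemma banach_lattice_refl: "leq x x"
  and banach_lattice_antisym: "leq x y \<Longrightarrow> leq y x \<Longrightarrow> x = y"
  and banach_lattice_trans: "leq x y \<Longrightarrow> leq y z \<Longrightarrow> leq x z"
  using banach_lattice_partial_order unfolding partial_order_order_on_carrier_iff by (meson UNIV_I)+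

text \<open>Translation by \<open>- x - y\<close> turns \<open>x\<close> into \<open>- y\<close> and
  \<open>y\<close> into \<open>- x\<close>.\<close>

lemma banach_lattice_neg: "leq x y \<Longrightarrow> leq (- y) (- x)"
  using banach_lattice_add[of x y "- x - y"] by simp

lemma banach_lattice_join:
  defines "j \<equiv> \<lambda>x y. x \<squnion>\<^bsub>order_on_carrier UNIV leq\<^esub> y"
  shows "leq x (j x y)" "leq y (j x y)" "leq x u \<Longrightarrow> leq y u \<Longrightarrow> leq (j x y) u"
proof -
  have "\<forall>x\<in>UNIV. \<forall>y\<in>UNIV. \<exists>s\<in>UNIV.
      leq x s \<and> leq y s \<and> (\<forall>u\<in>UNIV. leq x u \<longrightarrow> leq y u \<longrightarrow> leq s u)"
    using banach_lattice_lattice unfolding lattice_order_on_carrier_iff by (elim conjE)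
  then obtain s where s: "leq x s" "leq y s" "\<And>u. leq x u \<Longrightarrow> leq y u \<Longrightarrow> leq s u"
    by (meson UNIV_I)
  then have "j x y = s"
    unfolding j_def by (intro join_order_on_carrier_eqI[OF banach_lattice_partial_order]) auto
  then show "leq x (j x y)" "leq y (j x y)" "leq x u \<Longrightarrow> leq y u \<Longrightarrow> leq (j x y) u"
    using s by auto
qed

abbreviation (input) "modulus \<equiv> modulus_on UNIV leq"

lemma banach_lattice_modulus: "leq x (modulus x)" "leq (- x) (modulus x)"
    "leq x u \<Longrightarrow> leq (- x) u \<Longrightarrow> leq (modulus x) u"
  unfolding modulus_on_def by (rule banach_lattice_join; assumption)+

text \<open>Adding the bounds of \<open>x\<close> and \<open>- x\<close> by the modulus shows that
  twice the modulus is nonnegative; scaling by \<open>1/2\<close> finishes.\<close>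

lemma banach_lattice_modulus_nonneg: "leq 0 (modulus x)"
proof -
  have "leq 0 (- x + modulus x)"
    using banach_lattice_add[OF banach_lattice_modulus(1)[of x], of "- x"] by simp
  moreover have "leq (- x + modulus x) (modulus x + modulus x)"
    by (rule banach_lattice_add[OF banach_lattice_modulus(2)])
  ultimately have "leq 0 (modulus x + modulus x)" by (rule banach_lattice_trans)
  then have "leq ((1/2) *\<^sub>R 0) ((1/2) *\<^sub>R (modulus x + modulus x))"
    by (rule banach_lattice_scale[rotated]) simp
  then show ?thesis by (simp flip: scaleR_2)
qed

lemma banach_lattice_modulus_of_nonneg:
  assumes "leq 0 u"
  shows "modulus u = u"
proof (rule banach_lattice_antisym)
  have "leq (- u) u" using banach_lattice_trans[OF banach_lattice_neg[OF assms], of u] assms by simp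
  then show "leq (modulus u) u" by (rule banach_lattice_modulus(3)[OF banach_lattice_refl])
qed (rule banach_lattice_modulus)

text \<open>The modulus is idempotent, so \<open>x\<close> and \<open>modulus x\<close> have the
  same modulus and monotonicity of the norm applies both ways.\<close>

lemma banach_lattice_norm_modulus: "norm (modulus x) = norm x"
  using banach_lattice_norm[of x "modulus x"] banach_lattice_norm[of "modulus x" x]
    banach_lattice_modulus_of_nonneg[OF banach_lattice_modulus_nonneg, of x] banach_lattice_refl
  by (simp add: antisym)

text \<open>The sum \<open>?u\<close> of the moduli bounds the join \<open>?j\<close> from above,
  and \<open>- ?j\<close> lies below \<open>- x\<close>, hence also below \<open>?u\<close>. So the
  modulus of \<open>?j\<close> is at most \<open>?u\<close>, which is its own modulus, and the norm
  is monotone.\<close>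

lemma banach_lattice_norm_join: "norm (x \<squnion>\<^bsub>order_on_carrier UNIV leq\<^esub> y) \<le> norm x + norm y"
proof -
  let ?j = "x \<squnion>\<^bsub>order_on_carrier UNIV leq\<^esub> y" and ?u = "modulus x + modulus y"
  have xu: "leq (modulus x) ?u" and yu: "leq (modulus y) ?u"
    using banach_lattice_add[OF banach_lattice_modulus_nonneg[of y], of "modulus x"]
      banach_lattice_add[OF banach_lattice_modulus_nonneg[of x], of "modulus y"]
    by (simp_all add: add.commute)
  have u0: "leq 0 ?u"
    by (rule banach_lattice_trans[OF banach_lattice_modulus_nonneg xu])
  have "leq ?j ?u"
    by (rule banach_lattice_join(3)[OF banach_lattice_trans[OF banach_lattice_modulus(1) xu]
          banach_lattice_trans[OF banach_lattice_modulus(1) yu]])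
  moreover have "leq (- ?j) ?u"
    by (rule banach_lattice_trans[OF banach_lattice_trans[OF
          banach_lattice_neg[OF banach_lattice_join(1)] banach_lattice_modulus(2)] xu])
  ultimately have "leq (modulus ?j) (modulus ?u)"
    using banach_lattice_modulus(3)[of ?j ?u] banach_lattice_modulus_of_nonneg[OF u0] by simp
  then have "norm ?j \<le> norm ?u" by (rule banach_lattice_norm)
  also have "\<dots> \<le> norm x + norm y"
    using norm_triangle_ineq[of "modulus x" "modulus y"] by (simp add: banach_lattice_norm_modulus)
  finally show ?thesis .
qed

end

section \<open>The coordinatewise Banach lattice structure of \<open>ell Y\<close>\<close>

lemma banach_lattice_on_ell:
  fixes leq :: "'e::banach \<Rightarrow> 'e \<Rightarrow> bool"
  assumes Y: "banach_sequence_lattice Y N" and E: "banach_lattice_on UNIV norm leq"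
  shows "banach_lattice_on (ell Y) (ell_norm N) (componentwise leq)"
proof -
  let ?V = "ell Y :: (nat \<Rightarrow> 'e) set" and ?le = "componentwise leq"
  let ?J = "\<lambda>v w j. v j \<squnion>\<^bsub>order_on_carrier UNIV leq\<^esub> w j"
  note sub = normed_space_onD(1)[OF normed_space_on_ell[OF Y, where ?'e = 'e]]
  have po: "partial_order (order_on_carrier ?V ?le)"
    unfolding partial_order_order_on_carrier_iff componentwise_def fun_eq_iff
    using banach_lattice_refl[OF E] banach_lattice_antisym[OF E] banach_lattice_trans[OF E] by blast
  \<comment> \<open>The norm bound for joins gives domination by the sum of two norm sequences in
    \<open>Y\<close>.\<close>
  have J_in: "?J v w \<in> ?V" if "v \<in> ?V" "w \<in> ?V" for v w
  proof (rule ell_solid[OF Y])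
    show "(\<lambda>j. norm (v j)) + (\<lambda>j. norm (w j)) \<in> Y"
      using that subspace_add normed_space_onD(1)[OF sequence_lattice_normed[OF Y]]
      by (auto simp: ell_def)
    show "norm (?J v w j) \<le> ((\<lambda>j. norm (v j)) + (\<lambda>j. norm (w j))) j" for j
      by (simp add: banach_lattice_norm_join[OF E])
  qed
  have J: "?le v (?J v w)" "?le w (?J v w)" "?le v u \<Longrightarrow> ?le w u \<Longrightarrow> ?le (?J v w) u" for v w u
    using banach_lattice_join[OF E] by (auto simp: componentwise_def)
  have neg: "?le v w \<Longrightarrow> ?le (- w) (- v)" for v w
    using banach_lattice_neg[OF E] by (simp add: componentwise_def)
  have "lattice (order_on_carrier ?V ?le)"
    unfolding lattice_order_on_carrier_iff
  proof (intro conjI ballI po)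
    fix v w assume vw: "v \<in> ?V" "w \<in> ?V"
    show "\<exists>s\<in>?V. ?le v s \<and> ?le w s \<and> (\<forall>u\<in>?V. ?le v u \<longrightarrow> ?le w u \<longrightarrow> ?le s u)"
      using J J_in[OF vw] by blast
    \<comment> \<open>Negation reverses the order, so meets are obtained from joins of
      negatives.\<close>
    let ?m = "- ?J (- v) (- w)"
    have "?m \<in> ?V" using J_in[of "- v" "- w"] vw subspace_neg[OF sub] by blast
    moreover have "?le ?m v" "?le ?m w"
      using neg[OF J(1), of "- v" "- w"] neg[OF J(2), of "- v" "- w"] by simp_all
    moreover have "?le u ?m" if "?le u v" "?le u w" for u
      using neg[OF J(3)[OF neg[OF that(1)] neg[OF that(2)]]] by simp
    ultimately show "\<exists>s\<in>?V. ?le s v \<and> ?le s w \<and> (\<forall>u\<in>?V. ?le u v \<longrightarrow> ?le u w \<longrightarrow> ?le u s)"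
      by blast
  qed
  \<comment> \<open>The join formed within \<open>?V\<close> is the coordinatewise one, so comparing
    moduli in \<open>ell Y\<close> means comparing them in \<open>'e\<close> at every
    coordinate.\<close>
  moreover have "modulus_on ?V ?le w = (\<lambda>j. modulus_on UNIV leq (w j))" if "w \<in> ?V" for w
  proof -
    have nw: "- w \<in> ?V" using that by (rule subspace_neg[OF sub])
    have "modulus_on ?V ?le w = ?J w (- w)"
      unfolding modulus_on_def
      using J J_in[OF that nw] that nw by (intro join_order_on_carrier_eqI[OF po]) blast+
    then show ?thesis by (simp add: modulus_on_def)
  qed
  moreover have "ell_norm N v \<le> ell_norm N w"
    if "w \<in> ?V" "?le (\<lambda>j. modulus_on UNIV leq (v j)) (\<lambda>j. modulus_on UNIV leq (w j))" for v w
    unfolding ell_norm_def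
    using that banach_lattice_norm[OF E]
    by (intro sequence_lattice_mono[OF Y]) (auto simp: ell_def componentwise_def)
  moreover have "?le (v + u) (w + u)" if "?le v w" for u v w
    using that banach_lattice_add[OF E] by (simp add: componentwise_def)
  moreover have "?le (c *\<^sub>R v) (c *\<^sub>R w)" if "c \<ge> 0" "?le v w" for c v w
    using that banach_lattice_scale[OF E] by (simp add: componentwise_def scaleR_fun_def)
  ultimately show ?thesis
    unfolding banach_lattice_on_def using banach_space_on_ell[OF Y] by auto
qed

theorem theorem16:
  fixes Y :: "(nat \<Rightarrow> real) set" and N :: "(nat \<Rightarrow> real) \<Rightarrow> real"
  assumes "banach_sequence_lattice Y N"
  shows "banach_space_on (ell Y :: (nat \<Rightarrow> 'e::banach) set) (ell_norm N) \<and>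
    banach_space_on (ell0 Y N :: (nat \<Rightarrow> 'e) set) (ell_norm N) \<and>
    (\<forall>leq :: 'e \<Rightarrow> 'e \<Rightarrow> bool. banach_lattice_on UNIV norm leq \<longrightarrow>
      banach_lattice_on (ell Y) (ell_norm N) (componentwise leq) \<and>
      banach_lattice_on (ell0 Y N) (ell_norm N) (componentwise leq))"
proof -
  note Y0 = banach_sequence_lattice_vanishing_tails[OF assms]
  show ?thesis
    unfolding ell0_eq_ell_vanishing_tails[OF assms]
    using banach_space_on_ell[OF assms] banach_space_on_ell[OF Y0]
      banach_lattice_on_ell[OF assms] banach_lattice_on_ell[OF Y0] by blast
qed

end
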